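(* There is an algorithm that, given integers $a_1,\dots,a_n \geq 1$ such that $a_{i+1}/a_i$ is an integer for all $i<n$, and integer intervals $R_1=[b_1,B_1],\dots,R_n=[b_n,B_n]$, decides in time $\mathcal{O}(n^2)$ whether there exists an integer $s \geq 0$ such that for every $i=1,\dots,n$ there is some $r_i\in R_i$ with $s\equiv r_i \pmod{a_i}$.
   Context: This is the feasibility problem of Fuzzy Simultaneous Congruences (FSC) with harmonic divisors. Running time counts arithmetic operations on the input numbers. *)

theory Defs
  imports "HOL-Library.Landau_Symbols" "HOL-Number_Theory.Cong"
begin

text \<open>
  Model of computation: while-programs over integer variables and integer arrays with
  unit cost. Every elementary step costs 1, independently of the size of the
  numbers involved: each arithmetic operation and comparison, but also each access to a
  constant, variable or array cell, each boolean connective, assignment and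
  branch. In particular index computations and control flow are charged as well, so the total
  cost bounds from above the number of arithmetic operations.
\<close>

type_synonym vname = string

text \<open>\<open>Div\<close> and \<open>Mod\<close> are the operations of type \<^typ>\<open>int\<close>: quotients are
  rounded down, \<open>x div 0 = 0\<close> and \<open>x mod 0 = x\<close>.\<close>

datatype aexp =
    Const int
  | Var vname
  | Cell vname aexp
  | Plus aexp aexp
  | Minus aexp aexp
  | Times aexp aexp
  | Div aexp aexp
  | Mod aexp aexp

datatype bexp =
    Less aexp aexp
  | Equal aexp aexp
  | BNot bexp
  | BAnd bexp bexp

datatype com =
    Skip
  | Assign vname aexp
  | Store vname aexp aexp
  | Seq com com
  | Cond bexp com com
  | While bexp com

record state =
  var :: "vname \<Rightarrow> int"
  arr :: "vname \<Rightarrow> int \<Rightarrow> int"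

fun aval :: "aexp \<Rightarrow> state \<Rightarrow> int" where
  "aval (Const k) s = k"
| "aval (Var x) s = var s x"
| "aval (Cell x e) s = arr s x (aval e s)"
| "aval (Plus e f) s = aval e s + aval f s"
| "aval (Minus e f) s = aval e s - aval f s"
| "aval (Times e f) s = aval e s * aval f s"
| "aval (Div e f) s = aval e s div aval f s"
| "aval (Mod e f) s = aval e s mod aval f s"

fun acost :: "aexp \<Rightarrow> nat" where
  "acost (Const k) = 1"
| "acost (Var x) = 1"
| "acost (Cell x e) = acost e + 1"
| "acost (Plus e f) = acost e + acost f + 1"
| "acost (Minus e f) = acost e + acost f + 1"
| "acost (Times e f) = acost e + acost f + 1"
| "acost (Div e f) = acost e + acost f + 1"
| "acost (Mod e f) = acost e + acost f + 1"

fun bval :: "bexp \<Rightarrow> state \<Rightarrow> bool" where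
  "bval (Less e f) s \<longleftrightarrow> aval e s < aval f s"
| "bval (Equal e f) s \<longleftrightarrow> aval e s = aval f s"
| "bval (BNot p) s \<longleftrightarrow> \<not> bval p s"
| "bval (BAnd p q) s \<longleftrightarrow> bval p s \<and> bval q s"

fun bcost :: "bexp \<Rightarrow> nat" where
  "bcost (Less e f) = acost e + acost f + 1"
| "bcost (Equal e f) = acost e + acost f + 1"
| "bcost (BNot p) = bcost p + 1"
| "bcost (BAnd p q) = bcost p + bcost q + 1"

text \<open>\<open>exec c s t s'\<close>: started in \<open>s\<close>, program \<open>c\<close> terminates in \<open>s'\<close> at total cost \<open>t\<close>.\<close>

inductive exec :: "com \<Rightarrow> state \<Rightarrow> nat \<Rightarrow> state \<Rightarrow> bool" where
  Skip: "exec Skip s 1 s"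
| Assign: "exec (Assign x e) s (acost e + 1) (s\<lparr>var := (var s)(x := aval e s)\<rparr>)"
| Store: "exec (Store x e f) s (acost e + acost f + 1)
    (s\<lparr>arr := (arr s)(x := (arr s x)(aval e s := aval f s))\<rparr>)"
| Seq: "exec c s t s' \<Longrightarrow> exec d s' t' s'' \<Longrightarrow> exec (Seq c d) s (t + t') s''"
| CondTrue: "bval p s \<Longrightarrow> exec c s t s' \<Longrightarrow> exec (Cond p c d) s (bcost p + 1 + t) s'"
| CondFalse: "\<not> bval p s \<Longrightarrow> exec d s t s' \<Longrightarrow> exec (Cond p c d) s (bcost p + 1 + t) s'"
| WhileFalse: "\<not> bval p s \<Longrightarrow> exec (While p c) s (bcost p + 1) s"
| WhileTrue: "bval p s \<Longrightarrow> exec c s t s' \<Longrightarrow> exec (While p c) s' t' s'' \<Longrightarrow>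
    exec (While p c) s (bcost p + 1 + t + t') s''"

inductive_cases exec_SkipE: "exec Skip s t s'"
inductive_cases exec_AssignE: "exec (Assign x e) s t s'"
inductive_cases exec_StoreE: "exec (Store x e f) s t s'"
inductive_cases exec_SeqE: "exec (Seq c d) s t s'"
inductive_cases exec_CondE: "exec (Cond p c d) s t s'"
inductive_cases exec_WhileE: "exec (While p c) s t s'"

lemma exec_deterministic:
  "exec c s t s' \<Longrightarrow> exec c s u s'' \<Longrightarrow> u = t \<and> s'' = s'"
proof (induction arbitrary: u s'' rule: exec.induct)
  case (Skip s)
  then show ?case by (elim exec_SkipE) simp
next
  case (Assign x e s)
  then show ?case by (elim exec_AssignE) simp
next
  case (Store x e f s)
  then show ?case by (elim exec_StoreE) simp
next
  case (Seq c s t s' d t' r)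
  from Seq.prems obtain t1 s1 t2 where
    "u = t1 + t2" "exec c s t1 s1" "exec d s1 t2 s''" by (rule exec_SeqE)
  moreover from this(2) have "t1 = t \<and> s1 = s'" by (rule Seq.IH(1))
  ultimately show ?case using Seq.IH(2)[of t2 s''] by simp
next
  case (CondTrue p s c t s' d)
  from CondTrue.prems CondTrue.hyps(1) obtain t1 where
    "u = bcost p + 1 + t1" "exec c s t1 s''" by (auto elim!: exec_CondE)
  with CondTrue.IH[of t1 s''] show ?case by simp
next
  case (CondFalse p s d t s' c)
  from CondFalse.prems CondFalse.hyps(1) obtain t1 where
    "u = bcost p + 1 + t1" "exec d s t1 s''" by (auto elim!: exec_CondE)
  with CondFalse.IH[of t1 s''] show ?case by simp
next
  case (WhileFalse p s c)
  from WhileFalse.prems show ?case by (rule exec_WhileE) (use WhileFalse.hyps in simp_all)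
next
  case (WhileTrue p s c t s' t' r)
  from WhileTrue.prems show ?case
  proof (rule exec_WhileE)
    assume "\<not> bval p s"
    with WhileTrue.hyps show ?thesis by simp
  next
    fix t1 s1 t2
    assume u: "u = Suc (bcost p + t1 + t2)" and "exec c s t1 s1"
      and rest: "exec (While p c) s1 t2 s''"
    from WhileTrue.IH(1)[OF this(2)] have "t1 = t \<and> s1 = s'" .
    with u rest WhileTrue.IH(2)[of t2 s''] show ?thesis by simp
  qed
qed

text \<open>
  An instance consists of the number \<open>n\<close> of congruences and of \<open>a i\<close>, \<open>b i\<close>, \<open>B i\<close> for
  \<open>1 \<le> i \<le> n\<close>; values at other indices are irrelevant. The interval \<open>{b i..B i}\<close> is
  empty if \<open>B i < b i\<close>.
\<close>

definition harmonic_divisors :: "nat \<Rightarrow> (nat \<Rightarrow> int) \<Rightarrow> bool" where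
  "harmonic_divisors n a \<longleftrightarrow>
    (\<forall>i\<in>{1..n}. a i \<ge> 1) \<and> (\<forall>i\<in>{1..<n}. a i dvd a (i + 1))"

definition fsc_feasible :: "nat \<Rightarrow> (nat \<Rightarrow> int) \<Rightarrow> (nat \<Rightarrow> int) \<Rightarrow> (nat \<Rightarrow> int) \<Rightarrow> bool" where
  "fsc_feasible n a b B \<longleftrightarrow>
    (\<exists>s::int. s \<ge> 0 \<and> (\<forall>i\<in>{1..n}. \<exists>r\<in>{b i..B i}. [s = r] (mod a i)))"

definition input_array :: "nat \<Rightarrow> (nat \<Rightarrow> int) \<Rightarrow> int \<Rightarrow> int" where
  "input_array n f j = (if 1 \<le> j \<and> j \<le> int n then f (nat j) else 0)"

text \<open>The input is stored in variable \<open>n\<close> and arrays \<open>a\<close>, \<open>b\<close>, \<open>B\<close>;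
  all other memory is zero.\<close>

definition fsc_input :: "nat \<Rightarrow> (nat \<Rightarrow> int) \<Rightarrow> (nat \<Rightarrow> int) \<Rightarrow> (nat \<Rightarrow> int) \<Rightarrow> state" where
  "fsc_input n a b B =
    \<lparr>var = (\<lambda>_. 0)(''n'' := int n),
     arr = (\<lambda>_ _. 0)(''a'' := input_array n a, ''b'' := input_array n b, ''B'' := input_array n B)\<rparr>"

definition decides_harmonic_fsc_within :: "com \<Rightarrow> (nat \<Rightarrow> nat) \<Rightarrow> bool" where
  "decides_harmonic_fsc_within c T \<longleftrightarrow>
    (\<forall>n a b B. harmonic_divisors n a \<longrightarrow>
      (\<exists>t s. exec c (fsc_input n a b B) t s \<and> t \<le> T n \<and>
        var s ''result'' = (if fsc_feasible n a b B then 1 else 0)))"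

end

theory Submission
  imports Defs
begin

text \<open>
  The constraints are processed from the largest divisor to the smallest. After constraints
  \<open>i, \<dots>, n\<close> the residues modulo \<open>a i\<close> of the integers satisfying all of them form a union of arcs
  \<open>{l..u} + a i \<int>\<close>. Since \<open>a (i - 1)\<close> divides \<open>a i\<close>, reduction modulo \<open>a (i - 1)\<close> leaves the list
  of endpoints unchanged. Intersecting an arc with the arc \<open>{b..B} + a \<int>\<close> yields one arc that
  replaces it and possibly a second one, but the latter starts at \<open>b\<close>; all these second
  arcs together are therefore a single arc \<open>{b..M} + a \<int>\<close>. So the number of arcs grows by just
  one per constraint, no sorting is needed, and the total cost is quadratic.
\<close>

section \<open>Arcs modulo an integer\<close>

text \<open>Endpoints need not be reduced, and \<open>u < l\<close> is allowed: empty arcs can stay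
  in the list, so clipping never deletes an entry.\<close>

definition arc :: "int \<Rightarrow> int \<Rightarrow> int \<Rightarrow> int set" where
  "arc a l u = {s. \<exists>r\<in>{l..u}. [s = r] (mod a)}"

definition arcs :: "int \<Rightarrow> (int \<Rightarrow> int) \<Rightarrow> (int \<Rightarrow> int) \<Rightarrow> int set \<Rightarrow> int set" where
  "arcs a l u J = (\<Union>j\<in>J. arc a (l j) (u j))"

lemma arc_eq_empty_iff: "arc a l u = {} \<longleftrightarrow> u < l"
proof -
  have "l \<in> arc a l u" if "l \<le> u"
    using that by (auto simp: arc_def intro!: bexI[of _ l])
  moreover have "arc a l u = {}" if "u < l"
    using that by (simp add: arc_def)
  ultimately show ?thesis
    by (metis empty_iff not_le)
qed

lemma arcs_insert: "arcs a l u (insert j J) = arc a (l j) (u j) \<union> arcs a l u J"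
  by (simp add: arcs_def)

lemma arcs_empty [simp]: "arcs a l u {} = {}"
  by (simp add: arcs_def)

lemma arcs_upd:
  "j \<notin> J \<Longrightarrow> arcs a (l(j := x)) (u(j := y)) J = arcs a l u J"
  unfolding arcs_def by (rule SUP_cong) auto

lemma mem_arc_cong: "[s = t] (mod a) \<Longrightarrow> s \<in> arc a l u \<longleftrightarrow> t \<in> arc a l u"
  by (simp add: arc_def cong_def)

text \<open>A representative \<open>r\<close> in \<open>{x..y}\<close> itself lies in the arc modulo
  \<open>a\<close>, so it witnesses both directions. This is why the stored endpoints survive a
  change of modulus.\<close>

lemma arcs_dvd:
  assumes "d dvd a"
  shows "arcs d l u J = {s. \<exists>t\<in>arcs a l u J. [s = t] (mod d)}"
proof -
  have "s \<in> arc d x y \<longleftrightarrow> (\<exists>t\<in>arc a x y. [s = t] (mod d))" for s x y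
  proof
    assume "s \<in> arc d x y"
    then obtain r where "r \<in> {x..y}" "[s = r] (mod d)"
      unfolding arc_def by blast
    moreover from this have "r \<in> arc a x y"
      unfolding arc_def using cong_refl by blast
    ultimately show "\<exists>t\<in>arc a x y. [s = t] (mod d)"
      by blast
  next
    assume "\<exists>t\<in>arc a x y. [s = t] (mod d)"
    then obtain t r where "[s = t] (mod d)" "[t = r] (mod a)" "r \<in> {x..y}"
      unfolding arc_def by blast
    moreover from this have "[s = r] (mod d)"
      using cong_trans cong_dvd_modulus[OF _ assms] by blast
    ultimately show "s \<in> arc d x y"
      unfolding arc_def by blast
  qed
  then show ?thesis
    unfolding arcs_def by blast
qed

lemma arc_shift:
  assumes "[l = l'] (mod a)"
  shows "arc a l (l + w) = arc a l' (l' + w)"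
proof -
  have *: "arc a l (l + w) \<subseteq> arc a l' (l' + w)" if "[l = l'] (mod a)" for l l'
  proof
    fix s assume "s \<in> arc a l (l + w)"
    then obtain r where r: "r \<in> {l..l + w}" "[s = r] (mod a)"
      by (auto simp: arc_def)
    have "[r = r - l + l'] (mod a)"
      using cong_add[OF cong_refl that, of "r - l"] by simp
    with r have "[s = r - l + l'] (mod a)"
      using cong_trans by blast
    moreover have "r - l + l' \<in> {l'..l' + w}"
      using r by auto
    ultimately show "s \<in> arc a l' (l' + w)"
      unfolding arc_def by blast
  qed
  show ?thesis
    using * assms cong_sym by blast
qed

lemma arc_cap:
  assumes "a \<ge> 1"
  shows "arc a l (min u (l + (a - 1))) = arc a l u"
proof
  show "arc a l (min u (l + (a - 1))) \<subseteq> arc a l u"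
    by (auto simp: arc_def)
  show "arc a l u \<subseteq> arc a l (min u (l + (a - 1)))"
  proof
    fix s assume "s \<in> arc a l u"
    then obtain r where r: "l \<le> r" "r \<le> u" "[s = r] (mod a)"
      by (auto simp: arc_def)
    \<comment> \<open>The least integer \<ge> \<open>l\<close> in the residue class of
      \<open>r\<close>.\<close>
    let ?q = "l + (r - l) mod a"
    have "(r - l) mod a \<le> r - l"
      using r assms by (intro zmod_le_nonneg_dividend) auto
    moreover have "0 \<le> (r - l) mod a" "(r - l) mod a < a"
      using assms by auto
    ultimately have "?q \<in> {l..min u (l + (a - 1))}"
      using r by auto
    moreover have "[s = ?q] (mod a)"
      using r(3) by (simp add: cong_def mod_simps)
    ultimately show "s \<in> arc a l (min u (l + (a - 1)))"
      unfolding arc_def by blast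
  qed
qed

text \<open>Here \<open>l'\<close> is the lift of \<open>l\<close> in the window
  \<open>{b..b + a - 1}\<close>, and the arc is cut to at most one full turn. Then only the lift
  \<open>{l'..u'}\<close> and its translate by \<open>-a\<close> can meet \<open>{b..B}\<close>. The
  translate starts below \<open>b\<close>, so its piece starts exactly at \<open>b\<close>. An empty
  input arc makes both pieces empty.\<close>

lemma arc_Int_arc:
  assumes "a \<ge> 1" "B \<le> b + (a - 1)"
    and l': "l' = b + (l - b) mod a" and u': "u' = l' + min (u - l) (a - 1)"
  shows "arc a l u \<inter> arc a b B = arc a l' (min u' B) \<union> arc a b (min B (u' - a))"
proof -
  have bounds: "b \<le> l'" "l' < b + a" "u' < l' + a"
    using assms by auto
  have "arc a l u = arc a l (l + min (u - l) (a - 1))"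
    using arc_cap[OF assms(1), of l u] by (simp add: min_add_distrib_right)
  also have "\<dots> = arc a l' u'"
    unfolding u' by (rule arc_shift) (simp add: l' cong_def mod_simps)
  finally have lu: "arc a l u = arc a l' u'" .
  show ?thesis
    unfolding lu
  proof (intro equalityI subsetI)
    fix s assume "s \<in> arc a l' u' \<inter> arc a b B"
    then obtain r q where rq: "l' \<le> r" "r \<le> u'" "[s = r] (mod a)" "b \<le> q" "q \<le> B" "[s = q] (mod a)"
      by (auto simp: arc_def)
    then have "[r = q] (mod a)"
      using cong_trans cong_sym by blast
    then obtain t where t: "r - q = a * t"
      by (auto simp: cong_iff_dvd_diff)
    \<comment> \<open>\<open>r - q\<close> is at least \<open>b - B > -a\<close>, and at most
      \<open>u' - b < l' + a - b < 2 * a\<close>.\<close>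
    have "a * (-1) < a * t" "a * t < a * 2"
      using t rq(1,2,4,5) bounds assms(2) by linarith+
    then have "t = 0 \<or> t = 1"
      using assms(1) by (simp only: mult_less_cancel_left_pos) linarith
    then show "s \<in> arc a l' (min u' B) \<union> arc a b (min B (u' - a))"
    proof
      assume "t = 0"
      then have "r \<in> {l'..min u' B}"
        using rq t by auto
      then show ?thesis
        using rq by (auto simp: arc_def)
    next
      assume "t = 1"
      then have "q \<in> {b..min B (u' - a)}"
        using rq t by auto
      then show ?thesis
        using rq unfolding arc_def by blast
    qed
  next
    fix s assume "s \<in> arc a l' (min u' B) \<union> arc a b (min B (u' - a))"
    then show "s \<in> arc a l' u' \<inter> arc a b B"
    proof
      assume "s \<in> arc a l' (min u' B)"
      then obtain r where "r \<in> {l'..min u' B}" "[s = r] (mod a)"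
        by (auto simp: arc_def)
      moreover from this have "r \<in> {l'..u'}" "r \<in> {b..B}"
        using bounds by auto
      ultimately show ?thesis
        unfolding arc_def by blast
    next
      assume "s \<in> arc a b (min B (u' - a))"
      then obtain q where q: "q \<in> {b..min B (u' - a)}" "[s = q] (mod a)"
        by (auto simp: arc_def)
      moreover have "q + a \<in> {l'..u'}" "q \<in> {b..B}"
        using q bounds by auto
      moreover have "[s = q + a] (mod a)"
        using q by (simp add: cong_def)
      ultimately show ?thesis
        unfolding arc_def by blast
    qed
  qed
qed

text \<open>Intervals with a common left end are nested. Hence the wrapped pieces of all arcs can be
  stored as one running maximum.\<close>

lemma arc_Un_arc: "arc a b (min B x) \<union> arc a b (min B y) = arc a b (min B (max x y))"
proof -
  have "{b..min B (max x y)} = {b..min B x} \<union> {b..min B y}"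
    by auto
  then show ?thesis
    by (auto simp: arc_def)
qed

section \<open>Total correctness with a cost bound\<close>

text \<open>The existential form amounts to total correctness, since \<open>exec\<close> is
  deterministic.\<close>

definition runs :: "com \<Rightarrow> nat \<Rightarrow> state \<Rightarrow> (state \<Rightarrow> bool) \<Rightarrow> bool" where
  "runs c T s Q \<longleftrightarrow> (\<exists>t s'. exec c s t s' \<and> t \<le> T \<and> Q s')"

lemma runs_mono:
  "runs c T s Q \<Longrightarrow> T \<le> T' \<Longrightarrow> (\<And>s'. Q s' \<Longrightarrow> Q' s') \<Longrightarrow> runs c T' s Q'"
  unfolding runs_def by (meson order_trans)

lemma runs_Seq:
  "runs c T s (\<lambda>s'. runs d T' s' Q) \<Longrightarrow> runs (Seq c d) (T + T') s Q"
  unfolding runs_def by (meson add_mono exec.Seq)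

text \<open>The index \<open>m\<close> of the invariant counts the iterations still to come, so it
  serves as the variant too. The final summand pays for the failing guard.\<close>

lemma runs_While:
  assumes step: "\<And>m s. I (Suc m) s \<Longrightarrow> bval p s \<and> runs c K s (I m)"
    and stop: "\<And>s. I 0 s \<Longrightarrow> \<not> bval p s"
  shows "I m s \<Longrightarrow> runs (While p c) (m * (bcost p + 1 + K) + (bcost p + 1)) s (I 0)"
proof (induction m arbitrary: s)
  case 0
  then show ?case
    using stop exec.WhileFalse unfolding runs_def by fastforce
next
  case (Suc m)
  from step[OF Suc.prems] obtain t s' where
    p: "bval p s" and c: "exec c s t s'" "t \<le> K" "I m s'"
    unfolding runs_def by blast
  from Suc.IH[OF c(3)] obtain t' s'' where
    w: "exec (While p c) s' t' s''" "t' \<le> m * (bcost p + 1 + K) + (bcost p + 1)" "I 0 s''"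
    unfolding runs_def by blast
  have "exec (While p c) s (bcost p + 1 + t + t') s''"
    using p c(1) w(1) by (rule exec.WhileTrue)
  moreover have "bcost p + 1 + t + t' \<le> Suc m * (bcost p + 1 + K) + (bcost p + 1)"
    using c w by simp
  ultimately show ?case
    using w(3) unfolding runs_def by blast
qed

fun loop_free :: "com \<Rightarrow> bool" where
  "loop_free (Seq c d) \<longleftrightarrow> loop_free c \<and> loop_free d"
| "loop_free (Cond p c d) \<longleftrightarrow> loop_free c \<and> loop_free d"
| "loop_free (While p c) \<longleftrightarrow> False"
| "loop_free _ \<longleftrightarrow> True"

text \<open>The maximum over both branches bounds every run of a loop-free program; loops are
  charged by \<open>runs_While\<close>.\<close>

fun cost :: "com \<Rightarrow> nat" where
  "cost Skip = 1"
| "cost (Assign x e) = acost e + 1"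
| "cost (Store x e f) = acost e + acost f + 1"
| "cost (Seq c d) = cost c + cost d"
| "cost (Cond p c d) = bcost p + 1 + max (cost c) (cost d)"
| "cost (While p c) = 0"

fun wp :: "com \<Rightarrow> (state \<Rightarrow> bool) \<Rightarrow> state \<Rightarrow> bool" where
  "wp Skip Q s \<longleftrightarrow> Q s"
| "wp (Assign x e) Q s \<longleftrightarrow> Q (s\<lparr>var := (var s)(x := aval e s)\<rparr>)"
| "wp (Store x e f) Q s \<longleftrightarrow> Q (s\<lparr>arr := (arr s)(x := (arr s x)(aval e s := aval f s))\<rparr>)"
| "wp (Seq c d) Q s \<longleftrightarrow> wp c (wp d Q) s"
| "wp (Cond p c d) Q s \<longleftrightarrow> (if bval p s then wp c Q s else wp d Q s)"
| "wp (While p c) Q s \<longleftrightarrow> False"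

lemma runs_loop_free: "loop_free c \<Longrightarrow> wp c Q s \<Longrightarrow> runs c (cost c) s Q"
proof (induction c arbitrary: Q s)
  case (Seq c d)
  then have "runs c (cost c) s (wp d Q)"
    by simp
  then have "runs c (cost c) s (\<lambda>s'. runs d (cost d) s' Q)"
    by (rule runs_mono) (use Seq in auto)
  then show ?case
    by (simp add: runs_Seq)
next
  case (Cond p c d)
  show ?case
  proof (cases "bval p s")
    case True
    then have "runs c (cost c) s Q"
      using Cond by simp
    then obtain t s' where "exec c s t s'" "t \<le> cost c" "Q s'"
      unfolding runs_def by blast
    moreover from this have "exec (Cond p c d) s (bcost p + 1 + t) s'"
      using True by (blast intro: exec.CondTrue)
    ultimately show ?thesis
      unfolding runs_def by (intro exI[of _ "bcost p + 1 + t"] exI[of _ s']) auto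
  next
    case False
    then have "runs d (cost d) s Q"
      using Cond by simp
    then obtain t s' where "exec d s t s'" "t \<le> cost d" "Q s'"
      unfolding runs_def by blast
    moreover from this have "exec (Cond p c d) s (bcost p + 1 + t) s'"
      using False by (blast intro: exec.CondFalse)
    ultimately show ?thesis
      unfolding runs_def by (intro exI[of _ "bcost p + 1 + t"] exI[of _ s']) auto
  qed
next
  case Skip
  then show ?case
    using exec.Skip[of s] unfolding runs_def by auto
next
  case (Assign x e)
  then show ?case
    using exec.Assign[of x e s] unfolding runs_def by (metis cost.simps(2) order_refl wp.simps(2))
next
  case (Store x e f)
  then show ?case
    using exec.Store[of x e f s] unfolding runs_def by (metis cost.simps(3) order_refl wp.simps(3))
qed simp_all

definition lower :: "vname \<Rightarrow> aexp \<Rightarrow> com" where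
  "lower x e = Cond (Less e (Var x)) (Assign x e) Skip"

definition raise :: "vname \<Rightarrow> aexp \<Rightarrow> com" where
  "raise x e = Cond (Less (Var x) e) (Assign x e) Skip"

lemma loop_free_lower_raise [simp]: "loop_free (lower x e)" "loop_free (raise x e)"
  by (simp_all add: lower_def raise_def)

lemma wp_lower [simp]: "wp (lower x e) Q s \<longleftrightarrow> Q (s\<lparr>var := (var s)(x := min (var s x) (aval e s))\<rparr>)"
  by (simp add: lower_def min_def)

lemma wp_raise [simp]: "wp (raise x e) Q s \<longleftrightarrow> Q (s\<lparr>var := (var s)(x := max (var s x) (aval e s))\<rparr>)"
  by (simp add: raise_def max_def)

section \<open>The program\<close>

text \<open>Computes \<open>l'\<close> and \<open>u'\<close> of \<open>arc_Int_arc\<close> for entry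
  \<open>j\<close>. The order matters: \<open>''M''\<close> must absorb \<open>u' - a\<close> before
  \<open>''u''\<close> is cut at \<open>''B''\<close>.\<close>

definition clip_body :: com where
  "clip_body =
    Seq (Assign ''l'' (Plus (Var ''b'') (Mod (Minus (Cell ''L'' (Var ''j'')) (Var ''b'')) (Var ''a''))))
   (Seq (Assign ''u'' (Minus (Cell ''U'' (Var ''j'')) (Cell ''L'' (Var ''j''))))
   (Seq (lower ''u'' (Minus (Var ''a'') (Const 1)))
   (Seq (Assign ''u'' (Plus (Var ''l'') (Var ''u'')))
   (Seq (raise ''M'' (Minus (Var ''u'') (Var ''a'')))
   (Seq (lower ''u'' (Var ''B''))
   (Seq (Store ''L'' (Var ''j'') (Var ''l''))
   (Seq (Store ''U'' (Var ''j'') (Var ''u''))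
        (Assign ''j'' (Plus (Var ''j'') (Const 1))))))))))"

text \<open>Scalars and arrays have separate name spaces; each scalar caches the current entry of
  its array. Cutting \<open>''B''\<close> to one full turn secures the length hypothesis of
  \<open>arc_Int_arc\<close>, and \<open>''M'' = b - 1\<close> encodes an empty collection of
  wrapped pieces.\<close>

definition load :: com where
  "load =
    Seq (Assign ''a'' (Cell ''a'' (Var ''i'')))
   (Seq (Assign ''b'' (Cell ''b'' (Var ''i'')))
   (Seq (Assign ''B'' (Cell ''B'' (Var ''i'')))
   (Seq (lower ''B'' (Plus (Var ''b'') (Minus (Var ''a'') (Const 1))))
   (Seq (Assign ''M'' (Minus (Var ''b'') (Const 1)))
        (Assign ''j'' (Const 0))))))"

text \<open>Only here is the collected arc cut at \<open>''B''\<close>. It is appended even when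
  empty, so that the number of arcs depends on \<open>i\<close> and \<open>n\<close> alone.\<close>

definition append_arc :: com where
  "append_arc =
    Seq (lower ''M'' (Var ''B''))
   (Seq (Store ''L'' (Var ''k'') (Var ''b''))
   (Seq (Store ''U'' (Var ''k'') (Var ''M''))
   (Seq (Assign ''k'' (Plus (Var ''k'') (Const 1)))
        (Assign ''i'' (Minus (Var ''i'') (Const 1))))))"

abbreviation for_j :: "com \<Rightarrow> com" where
  "for_j \<equiv> While (Less (Var ''j'') (Var ''k''))"

definition constraint_body :: com where
  "constraint_body = Seq load (Seq (for_j clip_body) append_arc)"

text \<open>The start is the single arc \<open>{0..a n}\<close>, which covers all residues; its left
  end is the initial zero of the memory.\<close>

definition init :: com where
  "init =
    Seq (Store ''U'' (Const 0) (Cell ''a'' (Var ''n'')))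
   (Seq (Assign ''i'' (Var ''n''))
        (Assign ''k'' (Const 1)))"

definition test_body :: com where
  "test_body =
    Seq (Cond (Less (Cell ''U'' (Var ''j'')) (Cell ''L'' (Var ''j''))) Skip (Assign ''result'' (Const 1)))
        (Assign ''j'' (Plus (Var ''j'') (Const 1)))"

definition fsc_program :: com where
  "fsc_program =
    Seq init
   (Seq (While (Less (Const 0) (Var ''i'')) constraint_body)
   (Seq (Assign ''j'' (Const 0)) (for_j test_body)))"

section \<open>Correctness\<close>

definition inputs :: "nat \<Rightarrow> (nat \<Rightarrow> int) \<Rightarrow> (nat \<Rightarrow> int) \<Rightarrow> (nat \<Rightarrow> int) \<Rightarrow> state \<Rightarrow> bool" where
  "inputs n a b B s \<longleftrightarrow> var s ''result'' = 0 \<and> arr s ''a'' = input_array n a \<and>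
    arr s ''b'' = input_array n b \<and> arr s ''B'' = input_array n B"

text \<open>With \<open>m\<close> arcs left, the union of the clipped arcs, the collected wrapped
  pieces and the still unclipped arcs intersected with the constraint is always the target
  \<open>X\<close>.\<close>

definition clip_inv ::
  "(state \<Rightarrow> bool) \<Rightarrow> nat \<Rightarrow> int \<Rightarrow> int \<Rightarrow> int \<Rightarrow> int \<Rightarrow> int set \<Rightarrow> nat \<Rightarrow> state \<Rightarrow> bool" where
  "clip_inv P k i a b B X m s \<longleftrightarrow> P s \<and> m \<le> k \<and>
    var s ''j'' = int k - int m \<and> var s ''k'' = int k \<and> var s ''i'' = i \<and>
    var s ''a'' = a \<and> var s ''b'' = b \<and> var s ''B'' = B \<and>
    arcs a (arr s ''L'') (arr s ''U'') {0..<int k - int m} \<union> arc a b (min B (var s ''M'')) \<union>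
      (arcs a (arr s ''L'') (arr s ''U'') {int k - int m..<int k} \<inter> arc a b B) = X"

lemma clip_step:
  assumes inv: "clip_inv (inputs n a b B) k i d c C X (Suc m) s" and "d \<ge> 1" "C \<le> c + (d - 1)"
  shows "wp clip_body (clip_inv (inputs n a b B) k i d c C X m) s"
proof -
  let ?L = "arr s ''L''" and ?U = "arr s ''U''"
  \<comment> \<open>The first entry not yet clipped.\<close>
  define j where "j = int k - int (Suc m)"
  define l' where "l' = c + (?L j - c) mod d"
  define u' where "u' = l' + min (?U j - ?L j) (d - 1)"
  have m: "int k - int m = j + 1" "0 \<le> j" "j < int k"
    using inv by (auto simp: clip_inv_def j_def)
  have vars: "var s ''j'' = j" "var s ''k'' = int k" "var s ''i'' = i" "var s ''a'' = d"
    "var s ''b'' = c" "var s ''B'' = C" "inputs n a b B s" "m \<le> k"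
    using inv by (auto simp: clip_inv_def j_def)
  let ?M = "var s ''M''"
  have low: "{0..<j + 1} = insert j {0..<j}" and high: "{j..<int k} = insert j {j + 1..<int k}"
    using m by auto
  have "arcs d (?L(j := l')) (?U(j := min u' C)) {0..<j + 1} \<union> arc d c (min C (max ?M (u' - d))) \<union>
      (arcs d (?L(j := l')) (?U(j := min u' C)) {j + 1..<int k} \<inter> arc d c C)
    = arcs d ?L ?U {0..<j} \<union> arc d l' (min u' C) \<union> (arc d c (min C ?M) \<union> arc d c (min C (u' - d))) \<union>
      (arcs d ?L ?U {j + 1..<int k} \<inter> arc d c C)"
    unfolding low arcs_insert arc_Un_arc by (auto simp: arcs_upd)
  \<comment> \<open>Read backwards, the intersection formula reassembles entry \<open>j\<close> from
    its two pieces and returns it to the unclipped part.\<close>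
  also have "\<dots> = arcs d ?L ?U {0..<j} \<union> arc d c (min C ?M) \<union> (arcs d ?L ?U {j..<int k} \<inter> arc d c C)"
    using arc_Int_arc[OF assms(2,3) l'_def u'_def]
    unfolding high arcs_insert by blast
  also have "\<dots> = X"
    using inv by (simp add: clip_inv_def j_def)
  finally have X: "arcs d (?L(j := l')) (?U(j := min u' C)) {0..<j + 1} \<union>
    arc d c (min C (max ?M (u' - d))) \<union>
    (arcs d (?L(j := l')) (?U(j := min u' C)) {j + 1..<int k} \<inter> arc d c C) = X" .
  show ?thesis
    using vars X
    by (simp add: clip_body_def clip_inv_def inputs_def m(1) flip: l'_def u'_def)
qed

section \<open>Descending through the divisor chain\<close>

definition sat :: "(nat \<Rightarrow> int) \<Rightarrow> (nat \<Rightarrow> int) \<Rightarrow> (nat \<Rightarrow> int) \<Rightarrow> nat set \<Rightarrow> int set" where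
  "sat a b B H = {s. \<forall>h\<in>H. s \<in> arc (a h) (b h) (B h)}"

text \<open>The value at \<open>0\<close> is immaterial for the instance; \<open>1\<close> keeps the divisor chain intact
  after the last constraint has been processed.\<close>

definition dv :: "(nat \<Rightarrow> int) \<Rightarrow> nat \<Rightarrow> int" where
  "dv a i = (if i = 0 then 1 else a i)"

text \<open>The residues modulo \<open>d\<close> of the solutions of the constraints above
  \<open>i\<close>, given as a union of full residue classes so that it can be compared with
  \<open>arcs\<close>.\<close>

definition sat_mod ::
  "nat \<Rightarrow> (nat \<Rightarrow> int) \<Rightarrow> (nat \<Rightarrow> int) \<Rightarrow> (nat \<Rightarrow> int) \<Rightarrow> nat \<Rightarrow> int \<Rightarrow> int set" where
  "sat_mod n a b B i d = {s. \<exists>t\<in>sat a b B {i<..n}. [s = t] (mod d)}"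

text \<open>Constraints above \<open>i\<close> are done and the modulus is already the next divisor.
  The initial arc plus one per processed constraint gives \<open>Suc n - i\<close> arcs.\<close>

definition main_inv ::
  "nat \<Rightarrow> (nat \<Rightarrow> int) \<Rightarrow> (nat \<Rightarrow> int) \<Rightarrow> (nat \<Rightarrow> int) \<Rightarrow> nat \<Rightarrow> state \<Rightarrow> bool" where
  "main_inv n a b B i s \<longleftrightarrow> inputs n a b B s \<and> i \<le> n \<and>
    var s ''i'' = int i \<and> var s ''k'' = int (Suc n - i) \<and>
    arcs (dv a i) (arr s ''L'') (arr s ''U'') {0..<int (Suc n - i)} = sat_mod n a b B i (dv a i)"

text \<open>Membership in the new arc depends only on the residue modulo \<open>a (Suc i)\<close>,
  so knowing the earlier solutions up to that modulus suffices.\<close>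

lemma sat_mod_step:
  assumes "i < n" "d dvd a (Suc i)"
  shows "{s. \<exists>t \<in> sat_mod n a b B (Suc i) (a (Suc i)) \<inter> arc (a (Suc i)) (b (Suc i)) (B (Suc i)).
      [s = t] (mod d)} = sat_mod n a b B i d"
proof -
  let ?a = "a (Suc i)" and ?R = "arc (a (Suc i)) (b (Suc i)) (B (Suc i))"
  have set: "{i<..n} = insert (Suc i) {Suc i<..n}"
    using assms(1) by auto
  have sat: "sat a b B {i<..n} = sat a b B {Suc i<..n} \<inter> ?R"
    unfolding set by (auto simp: sat_def)
  show ?thesis
  proof (intro equalityI subsetI)
    fix s assume "s \<in> {s. \<exists>t \<in> sat_mod n a b B (Suc i) ?a \<inter> ?R. [s = t] (mod d)}"
    then obtain t r where tr: "r \<in> sat a b B {Suc i<..n}" "[t = r] (mod ?a)" "t \<in> ?R" "[s = t] (mod d)"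
      by (auto simp: sat_mod_def)
    \<comment> \<open>The true solution \<open>r\<close> replaces its congruent copy
      \<open>t\<close>, first in the arc and then modulo \<open>d\<close>.\<close>
    then have "r \<in> ?R" "[s = r] (mod d)"
      using mem_arc_cong[of t r] assms(2) cong_dvd_modulus cong_trans by blast+
    with tr show "s \<in> sat_mod n a b B i d"
      by (auto simp: sat_mod_def sat)
  next
    fix s assume "s \<in> sat_mod n a b B i d"
    then obtain t where "t \<in> sat a b B {Suc i<..n}" "t \<in> ?R" "[s = t] (mod d)"
      by (auto simp: sat_mod_def sat)
    moreover from this have "t \<in> sat_mod n a b B (Suc i) ?a"
      by (auto simp: sat_mod_def intro: cong_refl)
    ultimately show "s \<in> {s. \<exists>t \<in> sat_mod n a b B (Suc i) ?a \<inter> ?R. [s = t] (mod d)}"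
      by blast
  qed
qed

lemma main_step:
  assumes harm: "harmonic_divisors n a" and inv: "main_inv n a b B (Suc i) s"
  shows "runs constraint_body
    (cost load + (n * (4 + cost clip_body) + 4 + cost append_arc)) s (main_inv n a b B i)"
proof -
  define d where "d = a (Suc i)"
  define c where "c = b (Suc i)"
  define C where "C = min (B (Suc i)) (c + (d - 1))"
  define k where "k = n - i"
  have i: "i < n" and vars: "inputs n a b B s" "var s ''i'' = int (Suc i)" "var s ''k'' = int k"
    and cover: "arcs d (arr s ''L'') (arr s ''U'') {0..<int k} = sat_mod n a b B (Suc i) d"
    using inv by (simp_all add: main_inv_def k_def d_def dv_def del: of_nat_diff)
  have d: "d \<ge> 1" and C: "C \<le> c + (d - 1)"
    using harm i by (auto simp: harmonic_divisors_def d_def C_def)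
  have dvd: "dv a i dvd d"
    using harm i by (auto simp: harmonic_divisors_def dv_def d_def)
  define X where "X = sat_mod n a b B (Suc i) d \<inter> arc d c (B (Suc i))"
  have arcC: "arc d c C = arc d c (B (Suc i))"
    unfolding C_def by (rule arc_cap[OF d])
  let ?I = "clip_inv (inputs n a b B) k (int (Suc i)) d c C X"
  \<comment> \<open>No wrapped piece has been collected when the loop starts.\<close>
  have "arc d c (min C (c - 1)) = {}"
    by (simp add: arc_eq_empty_iff)
  then have "wp load (?I k) s"
    using vars i cover
    by (simp add: load_def clip_inv_def inputs_def input_array_def X_def
        nat_add_distrib arcC flip: d_def c_def C_def)
  then have 1: "runs load (cost load) s (?I k)"
    by (rule runs_loop_free[rotated]) (simp add: load_def)
  have 2: "runs (for_j clip_body) (k * (4 + cost clip_body) + 4) s (?I 0)" if "?I k s" for s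
  proof -
    have "runs (for_j clip_body) (k * (bcost (Less (Var ''j'') (Var ''k'')) + 1 + cost clip_body) +
        (bcost (Less (Var ''j'') (Var ''k'')) + 1)) s (?I 0)"
      using that
    proof (rule runs_While[rotated 2])
      fix m s assume *: "?I (Suc m) s"
      then have "runs clip_body (cost clip_body) s (?I m)"
        using clip_step[OF * d C] by (intro runs_loop_free) (auto simp: clip_body_def)
      then show "bval (Less (Var ''j'') (Var ''k'')) s \<and> runs clip_body (cost clip_body) s (?I m)"
        using * by (simp add: clip_inv_def)
    qed (simp add: clip_inv_def)
    then show ?thesis
      by (simp add: algebra_simps eval_nat_numeral)
  qed
  have 3: "runs append_arc (cost append_arc) s (main_inv n a b B i)" if "?I 0 s" for s
  proof (rule runs_loop_free)
    let ?L = "(arr s ''L'')(int k := c)" and ?U = "(arr s ''U'')(int k := min (var s ''M'') C)"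
    have ins: "{0..<1 + int k} = insert (int k) {0..<int k}"
      by auto
    have "arcs d ?L ?U {0..<1 + int k} = X"
      using that unfolding ins arcs_insert
      by (auto simp: arcs_upd clip_inv_def min.commute)
    \<comment> \<open>The same endpoints are now read modulo \<open>dv a i\<close>, a divisor of
      \<open>d\<close>.\<close>
    then have "arcs (dv a i) ?L ?U {0..<1 + int k} = {s. \<exists>t\<in>X. [s = t] (mod dv a i)}"
      using arcs_dvd[OF dvd] by simp
    also have "\<dots> = sat_mod n a b B i (dv a i)"
      unfolding X_def d_def c_def by (rule sat_mod_step) (use i dvd in \<open>auto simp: d_def\<close>)
    finally have "arcs (dv a i) ?L ?U {0..<1 + int k} = sat_mod n a b B i (dv a i)" .
    moreover have "int (Suc n - i) = 1 + int k"
      using i by (simp add: k_def)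
    ultimately show "wp append_arc (main_inv n a b B i) s"
      using that i by (simp add: append_arc_def main_inv_def clip_inv_def inputs_def del: of_nat_diff)
  qed (simp add: append_arc_def)
  have "runs constraint_body
    (cost load + ((k * (4 + cost clip_body) + 4) + cost append_arc)) s (main_inv n a b B i)"
    unfolding constraint_body_def
    by (intro runs_Seq runs_mono[OF 1 order_refl] runs_mono[OF 2 order_refl] 3)
  then show ?thesis
    by (rule runs_mono) (simp_all add: k_def)
qed

section \<open>Feasibility, the final test and the total cost\<close>

text \<open>Modulo \<open>1\<close> only the existence of a solution remains. The sign condition
  costs nothing: reducing a solution modulo the product of all \<open>a i\<close> preserves every
  congruence.\<close>

lemma fsc_feasible_iff:
  assumes "harmonic_divisors n a"
  shows "fsc_feasible n a b B \<longleftrightarrow> sat_mod n a b B 0 1 \<noteq> {}"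
proof -
  let ?N = "\<Prod>i\<in>{1..n}. a i"
  have pos: "?N \<ge> 1"
    using assms by (intro prod_ge_1) (auto simp: harmonic_divisors_def)
  have "\<exists>t\<ge>0. t \<in> sat a b B {1..n}" if s: "s \<in> sat a b B {1..n}" for s
  proof (intro exI[of _ "s mod ?N"] conjI)
    show "0 \<le> s mod ?N"
      using pos by simp
    have "[s = s mod ?N] (mod a i)" if "i \<in> {1..n}" for i
      using cong_dvd_modulus[of s "s mod ?N" ?N "a i"] that by (simp add: dvd_prodI cong_def)
    then show "s mod ?N \<in> sat a b B {1..n}"
      using s mem_arc_cong unfolding sat_def by blast
  qed
  moreover have "{0<..n} = {1..n}"
    by auto
  ultimately have "sat_mod n a b B 0 1 \<noteq> {} \<longleftrightarrow> (\<exists>s\<ge>0. s \<in> sat a b B {1..n})"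
    by (auto simp: sat_mod_def)
  then show ?thesis
    by (simp add: fsc_feasible_def sat_def arc_def)
qed

definition test_inv :: "nat \<Rightarrow> int set \<Rightarrow> nat \<Rightarrow> state \<Rightarrow> bool" where
  "test_inv k Y m s \<longleftrightarrow> m \<le> k \<and> var s ''j'' = int k - int m \<and> var s ''k'' = int k \<and>
    arcs 1 (arr s ''L'') (arr s ''U'') {0..<int k} = Y \<and>
    var s ''result'' = (if arcs 1 (arr s ''L'') (arr s ''U'') {0..<int k - int m} = {} then 0 else 1)"

lemma test_step:
  assumes "test_inv k Y (Suc m) s"
  shows "wp test_body (test_inv k Y m) s"
proof -
  have "{0..<int k - int m} = insert (int k - int (Suc m)) {0..<int k - int (Suc m)}"
    using assms by (auto simp: test_inv_def)
  then show ?thesis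
    using assms by (auto simp: test_inv_def test_body_def arcs_insert arc_eq_empty_iff)
qed

text \<open>Each \<open>4\<close> is the guard of a loop, of cost 3, plus its branch. The quadratic
  part comes from at most \<open>n\<close> clips in each of \<open>n\<close> rounds; the last loop
  inspects \<open>Suc n\<close> arcs.\<close>

definition time_bound :: "nat \<Rightarrow> nat" where
  "time_bound n = cost init +
    ((n * (4 + (cost load + (n * (4 + cost clip_body) + 4 + cost append_arc))) + 4) +
    (2 + (Suc n * (4 + cost test_body) + 4)))"

lemma fsc_program_runs:
  assumes harm: "harmonic_divisors n a"
  shows "runs fsc_program (time_bound n) (fsc_input n a b B)
    (\<lambda>s. var s ''result'' = (if fsc_feasible n a b B then 1 else 0))"
proof -
  let ?Y = "sat_mod n a b B 0 1"
  \<comment> \<open>For \<open>n = 0\<close> the array cell reads 0 and the modulus is 1, so the arc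
    \<open>{0..0}\<close> still covers everything.\<close>
  have "arc (dv a n) 0 (input_array n a (int n)) = UNIV"
  proof -
    have "dv a n \<ge> 1"
      using harm by (auto simp: dv_def harmonic_divisors_def)
    then have "arc (dv a n) 0 (dv a n - 1) = UNIV"
      by (auto simp: arc_def cong_def intro!: bexI[of _ "_ mod dv a n"])
    moreover have "arc (dv a n) 0 (dv a n - 1) \<subseteq> arc (dv a n) 0 (input_array n a (int n))"
      by (auto simp: arc_def dv_def input_array_def)
    ultimately show ?thesis
      by blast
  qed
  moreover have "sat_mod n a b B n (dv a n) = UNIV"
    by (auto simp: sat_mod_def sat_def intro: cong_refl)
  moreover have "{0..<1} = {0::int}"
    by auto
  ultimately have "wp init (main_inv n a b B n) (fsc_input n a b B)"
    by (simp add: init_def main_inv_def fsc_input_def inputs_def arcs_def)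
  then have 1: "runs init (cost init) (fsc_input n a b B) (main_inv n a b B n)"
    by (intro runs_loop_free) (simp_all add: init_def)
  have 2: "runs (While (Less (Const 0) (Var ''i'')) constraint_body)
      (n * (4 + (cost load + (n * (4 + cost clip_body) + 4 + cost append_arc))) + 4) s
      (main_inv n a b B 0)" if "main_inv n a b B n s" for s
  proof -
    let ?K = "cost load + (n * (4 + cost clip_body) + 4 + cost append_arc)"
    have "runs (While (Less (Const 0) (Var ''i'')) constraint_body)
        (n * (bcost (Less (Const 0) (Var ''i'')) + 1 + ?K) + (bcost (Less (Const 0) (Var ''i'')) + 1)) s
        (main_inv n a b B 0)"
      using that
    proof (rule runs_While[rotated 2])
      fix m s assume *: "main_inv n a b B (Suc m) s"
      then show "bval (Less (Const 0) (Var ''i'')) s \<and> runs constraint_body ?K s (main_inv n a b B m)"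
        using main_step[OF harm *] by (simp add: main_inv_def)
    qed (simp add: main_inv_def)
    then show ?thesis
      by (simp add: eval_nat_numeral)
  qed
  \<comment> \<open>At \<open>i = 0\<close> the modulus \<open>dv a 0\<close> is 1, which matches
    the modulus of \<open>test_inv\<close>.\<close>
  have 3: "runs (Assign ''j'' (Const 0)) 2 s (test_inv (Suc n) ?Y (Suc n))"
    if "main_inv n a b B 0 s" for s
    using runs_loop_free[of "Assign ''j'' (Const 0)" "test_inv (Suc n) ?Y (Suc n)" s] that
    by (simp add: eval_nat_numeral main_inv_def test_inv_def inputs_def dv_def)
  have 4: "runs (for_j test_body) (Suc n * (4 + cost test_body) + 4) s (test_inv (Suc n) ?Y 0)"
    if "test_inv (Suc n) ?Y (Suc n) s" for s
  proof -
    have "runs (for_j test_body)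
        (Suc n * (bcost (Less (Var ''j'') (Var ''k'')) + 1 + cost test_body) +
        (bcost (Less (Var ''j'') (Var ''k'')) + 1)) s (test_inv (Suc n) ?Y 0)"
      using that
    proof (rule runs_While[rotated 2])
      fix m s assume *: "test_inv (Suc n) ?Y (Suc m) s"
      then have "runs test_body (cost test_body) s (test_inv (Suc n) ?Y m)"
        by (intro runs_loop_free test_step) (simp add: test_body_def)
      then show "bval (Less (Var ''j'') (Var ''k'')) s \<and>
          runs test_body (cost test_body) s (test_inv (Suc n) ?Y m)"
        using * by (simp add: test_inv_def)
    qed (simp add: test_inv_def)
    then show ?thesis
      by (simp add: algebra_simps eval_nat_numeral)
  qed
  have "runs fsc_program (time_bound n) (fsc_input n a b B) (test_inv (Suc n) ?Y 0)"
    unfolding fsc_program_def time_bound_def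
    by (intro runs_Seq runs_mono[OF 1 order_refl] runs_mono[OF 2 order_refl]
        runs_mono[OF 3 order_refl] 4)
  then show ?thesis
    by (rule runs_mono) (auto simp: test_inv_def fsc_feasible_iff[OF harm])
qed

lemma quadratic_bigo: "(\<lambda>n. real (p + q * n + r * n\<^sup>2)) \<in> O(\<lambda>n. real n ^ 2)"
proof (rule bigoI)
  show "\<forall>\<^sub>F n in sequentially. norm (real (p + q * n + r * n\<^sup>2)) \<le> real (p + q + r) * norm (real n ^ 2)"
    using eventually_ge_at_top[of 1]
  proof eventually_elim
    case (elim n)
    then have "p + q * n + r * n\<^sup>2 \<le> p * n\<^sup>2 + q * n\<^sup>2 + r * n\<^sup>2"
      by (intro add_mono mult_le_mono) (auto simp: power2_eq_square)
    then have "p + q * n + r * n\<^sup>2 \<le> (p + q + r) * n\<^sup>2"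
      by (simp add: algebra_simps)
    then have "real (p + q * n + r * n\<^sup>2) \<le> real ((p + q + r) * n\<^sup>2)"
      by (rule of_nat_mono)
    then show ?case
      by simp
  qed
qed

lemma time_bound_bigo: "(\<lambda>n. real (time_bound n)) \<in> O(\<lambda>n. real n ^ 2)"
proof -
  have "time_bound n = (cost init + cost test_body + 14) +
      (12 + cost load + cost append_arc + cost test_body) * n + (4 + cost clip_body) * n\<^sup>2" for n
    by (simp add: time_bound_def algebra_simps power2_eq_square)
  then show ?thesis
    by (simp only: quadratic_bigo)
qed

theorem theorem7:
  "\<exists>(c :: com) (T :: nat \<Rightarrow> nat).
    (\<lambda>n. real (T n)) \<in> O(\<lambda>n. real n ^ 2) \<and> decides_harmonic_fsc_within c T"
proof (intro exI conjI)
  show "(\<lambda>n. real (time_bound n)) \<in> O(\<lambda>n. real n ^ 2)"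
    by (rule time_bound_bigo)
  show "decides_harmonic_fsc_within fsc_program time_bound"
    using fsc_program_runs unfolding decides_harmonic_fsc_within_def runs_def by blast
qed

end
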